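(* Let $t\ge 1$ and let $S_{t+1}^{\circ}$ be the fully looped star on $t+1$ vertices $v_0,v_1,\ldots,v_t$, with $v_0$ the center of the star. Let $\mathbf{n}=(n_0,n_1,\ldots,n_t)$ be any vector of positive integers. The blow-up of $S_{t+1}^{\circ}$ by $\mathbf{n}$ is Hoffman-London.
   Context: The fully looped star $S_{t+1}^{\circ}$ has edges $v_0v_i$ for $1\le i\le t$ and a loop at each of $v_0,\ldots,v_t$. Blow-up: let $H$ be a graph on vertex set $\{v_0,\ldots,v_k\}$ without multiple edges but perhaps with loops, and let $\mathbf{n}=(n_0,\ldots,n_k)$ be a vector of positive integers. The blow-up $H^{\mathbf{n}}$ has vertex set $\bigcup_{i=0}^k V_i$, where the $V_i$ are pairwise disjoint sets with $|V_i|=n_i$. If $v_i\sim_H v_j$ (with either $i\ne j$ or $i=j$), then there is an edge in $H^{\mathbf{n}}$ between every $x\in V_i$ and $y\in V_j$ (so if $v_i$ is looped, $V_i$ induces a complete graph with a loop at every vertex), and there are no other edges. For a target graph $H$ (no multiple edges, possibly with loops) and a simple loopless graph $G$, an $H$-coloring of $G$ is a map $f:V(G)\to V(H)$ such that $f(u)\sim_H f(v)$ whenever $u\sim_G v$; $\hom(G,H)$ denotes the number of $H$-colorings of $G$. $\mathcal{T}_n$ is the set of all trees on $n$ vertices (up to isomorphism) and $P_n\in\mathcal{T}_n$ is the path on $n$ vertices. $H$ is Hoffman-London if for all $n\ge 1$, $\hom(P_n,H)=\min_{T_n\in\mathcal{T}_n}\hom(T_n,H)$. *)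

theory Defs
  imports "Graph_Theory.Graph_Theory" "HOL-Library.FuncSet"
begin

text \<open>
  Undirected graphs without multiple edges are symmetric digraphs given by a set of ordered
  pairs: an edge between \<open>u \<noteq> v\<close> is the two pairs \<open>(u, v)\<close> and \<open>(v, u)\<close>, a loop at \<open>v\<close> is the
  pair \<open>(v, v)\<close>.  Finite graphs with loops allowed are \<^locale>\<open>pair_pseudo_graph\<close>s, finite simple
  loopless graphs are \<^locale>\<open>pair_graph\<close>s.
\<close>

text \<open>
  The library constant \<^const>\<open>tree\<close> is not usable here: it forbids every directed cycle, and in a
  symmetric digraph each edge traversed back and forth is one, of length 2.  In a loopless symmetric
  digraph the directed cycles of length at least 3 are exactly the (oriented) cycles of the
  underlying simple graph.
\<close>

definition undirected_tree :: "'a pair_pre_digraph \<Rightarrow> bool" where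
  "undirected_tree T \<longleftrightarrow> pair_graph T \<and> connected (with_proj T) \<and>
     \<not> (\<exists>p. pre_digraph.cycle (with_proj T) p \<and> 3 \<le> length p)"

text \<open>
  Every tree on \<open>n\<close> vertices has an isomorphic copy with vertex set \<open>{0..<n}\<close>; isomorphic copies
  may occur repeatedly, which does not affect a minimum of an isomorphism invariant.
\<close>

definition trees :: "nat \<Rightarrow> nat pair_pre_digraph set" where
  "trees n = {T. undirected_tree T \<and> pverts T = {0..<n}}"

definition path_graph :: "nat \<Rightarrow> nat pair_pre_digraph" where
  "path_graph n = \<lparr> pverts = {0..<n},
     parcs = {(i, j). i < n \<and> j < n \<and> (j = Suc i \<or> i = Suc j)} \<rparr>"

definition colorings :: "'a pair_pre_digraph \<Rightarrow> 'b pair_pre_digraph \<Rightarrow> ('a \<Rightarrow> 'b) set" where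
  "colorings G H =
     {f \<in> pverts G \<rightarrow>\<^sub>E pverts H. \<forall>u v. (u, v) \<in> parcs G \<longrightarrow> (f u, f v) \<in> parcs H}"

definition hom_count :: "'a pair_pre_digraph \<Rightarrow> 'b pair_pre_digraph \<Rightarrow> nat" where
  "hom_count G H = card (colorings G H)"

definition hoffman_london :: "'b pair_pre_digraph \<Rightarrow> bool" where
  "hoffman_london H \<longleftrightarrow>
     (\<forall>n\<ge>1. hom_count (path_graph n) H = Min ((\<lambda>T. hom_count T H) ` trees n))"

text \<open>The looped star with center \<open>0\<close> and leaves \<open>1, \<dots>, t\<close>; it has \<open>t + 1\<close> vertices.\<close>

definition looped_star :: "nat \<Rightarrow> nat pair_pre_digraph" where
  "looped_star t = \<lparr> pverts = {0..t},
     parcs = {(0, i) | i. 1 \<le> i \<and> i \<le> t} \<union> {(i, 0) | i. 1 \<le> i \<and> i \<le> t} \<union> {(i, i) | i. i \<le> t} \<rparr>"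

text \<open>The class replacing the vertex \<open>v\<close> is \<open>V\<^sub>v = {v} \<times> {0..<n v}\<close>.\<close>

definition blow_up :: "'a pair_pre_digraph \<Rightarrow> ('a \<Rightarrow> nat) \<Rightarrow> ('a \<times> nat) pair_pre_digraph" where
  "blow_up H n = \<lparr> pverts = (SIGMA v : pverts H. {0..<n v}),
     parcs = {((u, a), (v, b)) | u a v b. (u, v) \<in> parcs H \<and> a < n u \<and> b < n v} \<rparr>"

lemma pair_pseudo_graph_looped_star: "pair_pseudo_graph (looped_star t)"
proof unfold_locales
  have "parcs (looped_star t) \<subseteq> {0..t} \<times> {0..t}"
    by (auto simp: looped_star_def)
  then show "finite (parcs (looped_star t))"
    by (rule finite_subset) simp
qed (auto simp: looped_star_def symmetric_def sym_def)

lemma pair_pseudo_graph_blow_up: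
  assumes "pair_pseudo_graph H"
  shows "pair_pseudo_graph (blow_up H n)"
proof -
  interpret pair_pseudo_graph H by fact
  have fin: "finite (pverts (blow_up H n))"
    using pair_finite_verts by (simp add: blow_up_def)
  show ?thesis
  proof unfold_locales
    have "parcs (blow_up H n) \<subseteq> pverts (blow_up H n) \<times> pverts (blow_up H n)"
      by (auto simp: blow_up_def dest: in_arcsD1 in_arcsD2)
    then show "finite (parcs (blow_up H n))"
      using fin by (meson finite_SigmaI finite_subset)
    show "symmetric (blow_up H n)"
      using pair_sym_arcs by (auto simp: blow_up_def symmetric_def sym_def)
  qed (use fin in \<open>auto simp: blow_up_def dest: in_arcsD1 in_arcsD2\<close>)
qed

lemma finite_trees: "finite (trees n)"
proof -
  have "trees n \<subseteq> (\<lambda>E. \<lparr>pverts = {0..<n}, parcs = E\<rparr>) ` Pow ({0..<n} \<times> {0..<n})"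
  proof
    fix T assume "T \<in> trees n"
    then have T: "pair_graph T" "pverts T = {0..<n}"
      by (auto simp: trees_def undirected_tree_def)
    interpret pair_graph T by fact
    have "parcs T \<subseteq> {0..<n} \<times> {0..<n}"
      using T(2) by (auto dest: in_arcsD1 in_arcsD2)
    moreover have "T = \<lparr>pverts = {0..<n}, parcs = parcs T\<rparr>"
      using T(2) by simp
    ultimately show "T \<in> (\<lambda>E. \<lparr>pverts = {0..<n}, parcs = E\<rparr>) ` Pow ({0..<n} \<times> {0..<n})"
      by blast
  qed
  then show ?thesis
    by (rule finite_subset) simp
qed

lemma path_graph_in_trees:
  assumes "1 \<le> n"
  shows "path_graph n \<in> trees n"
proof -
  let ?P = "path_graph n"
  have sub: "parcs ?P \<subseteq> {0..<n} \<times> {0..<n}"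
    by (auto simp: path_graph_def)
  have graph: "pair_graph ?P"
  proof unfold_locales
    show "finite (parcs ?P)"
      using sub by (rule finite_subset) simp
  qed (auto simp: path_graph_def symmetric_def sym_def)
  interpret pair_graph ?P by (fact graph)
  have reach0: "(0, v) \<in> rtrancl_on {0..<n} (parcs ?P)" if "v < n" for v
    using that
  proof (induction v)
    case (Suc v)
    moreover have "(v, Suc v) \<in> parcs ?P"
      using Suc.prems by (simp add: path_graph_def)
    ultimately show ?case
      by (meson Suc_lessD atLeastLessThan_iff le0 rtrancl_on_into_rtrancl_on)
  qed auto
  have sym: "sym (rtrancl_on {0..<n} (parcs ?P))"
    using pair_sym_arcs by (simp add: symmetric_def rtrancl_on_sym)
  have "strongly_connected (with_proj ?P)"
    unfolding strongly_connected_def reachable_def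
  proof safe
    fix u v assume "u \<in> verts ?P" "v \<in> verts ?P"
    then show "(u, v) \<in> rtrancl_on (verts ?P) (arcs_ends ?P)"
      using reach0 sym by (auto simp: path_graph_def dest: symD intro: rtrancl_on_trans)
  qed (use assms in \<open>auto simp: path_graph_def\<close>)
  moreover have "mk_symmetric (with_proj ?P) = ?P"
    by (auto simp: mk_symmetric_def path_graph_def)
  ultimately have con: "connected (with_proj ?P)"
    by (simp add: connected_def)
  have False if cyc: "cycle p" and len: "3 \<le> length p" for p
  proof -
    obtain u where aw: "awalk u p u" and dist: "distinct (tl (pawalk_verts u p))"
      using cyc by (auto simp: cycle_def)
    have verts: "pawalk_verts u q = u # map snd q" if "pcas u q v" for u v and q :: "(nat \<times> nat) list"
      using that by (induction q arbitrary: u) auto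
    have step: "fst (q ! Suc i) = snd (q ! i)" if "pcas u q v" "Suc i < length q"
      for u v i and q :: "(nat \<times> nat) list"
      using that
    proof (induction q arbitrary: u i)
      case (Cons e q)
      then show ?case by (cases i; cases q) auto
    qed simp
    have last: "snd (last q) = v" if "pcas u q v" "q \<noteq> []" for u v and q :: "(nat \<times> nat) list"
      using that by (induction q arbitrary: u) auto
    have cas: "pcas u p u" and arcs: "set p \<subseteq> parcs ?P"
      using aw by (auto simp: awalk_def)
    have ne: "p \<noteq> []" using len by auto
    have d: "distinct (map snd p)"
      using dist verts[OF cas] by simp
    have first: "fst (p ! 0) = snd (p ! (length p - 1))"
    proof -
      have "fst (p ! 0) = u" using cas ne by (cases p) auto
      then show ?thesis using last[OF cas ne] by (simp add: last_conv_nth[OF ne])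
    qed
    define L where "L = length p"
    define nx where "nx i = (if Suc i = L then 0 else Suc i)" for i
    define pv where "pv i = (if i = 0 then L - 1 else i - 1)" for i
    have L: "3 \<le> L" using len by (simp add: L_def)
    have nx: "fst (p ! nx i) = snd (p ! i)" "nx i < L" if "i < L" for i
    proof -
      have "length p - 1 = i" if "Suc i = L" using that by (simp add: L_def)
      then show "fst (p ! nx i) = snd (p ! i)"
        using that first step[OF cas, of i] by (cases "Suc i = L") (auto simp: nx_def L_def)
    qed (use that in \<open>auto simp: nx_def\<close>)
    have pv: "fst (p ! i) = snd (p ! pv i)" "pv i < L" if "i < L" for i
      using that first step[OF cas, of "i - 1"] by (auto simp: pv_def L_def)
    have arc: "snd (p ! i) = Suc (fst (p ! i)) \<or> fst (p ! i) = Suc (snd (p ! i))" if "i < L" for i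
    proof -
      have "p ! i \<in> parcs ?P" using arcs that by (auto simp: L_def)
      then show ?thesis by (cases "p ! i") (auto simp: path_graph_def)
    qed
    obtain i where i: "i < L" and max: "\<And>j. j < L \<Longrightarrow> snd (p ! j) \<le> snd (p ! i)"
    proof -
      let ?S = "(\<lambda>j. snd (p ! j)) ` {..<L}"
      have "Max ?S \<in> ?S" using L by (intro Max_in) (auto simp: lessThan_empty_iff)
      then obtain i where "i < L" "snd (p ! i) = Max ?S" by auto
      then show ?thesis by (intro that[of i]) auto
    qed
    have "snd (p ! nx i) = snd (p ! pv i)"
      using arc[OF i] arc[OF nx(2)[OF i]] nx(1)[OF i] pv(1)[OF i]
        max[OF nx(2)[OF i]] max[OF pv(2)[OF i]] by auto
    then have "nx i = pv i"
      using d nx(2)[OF i] pv(2)[OF i] by (auto simp: distinct_conv_nth L_def)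
    then show False
      using L i by (auto simp: nx_def pv_def split: if_splits)
  qed
  then show ?thesis
    using graph con by (auto simp: trees_def undirected_tree_def path_graph_def)
qed

end

theory Submission
  imports Defs "HOL-Library.Indicator_Function"
begin

text \<open>
  Rank the vertices of the blow-up by the size of their class, with the central class on top.  Then
  the adjacency operator \<open>A\<close> preserves nonnegative functions that increase with the rank, so for
  every rooted tree the number of colorings with prescribed colour at the root increases with the
  rank of that colour, even if vertices carry increasing weights.  As \<open>A\<close> is symmetric with
  nonnegative entries, Chebyshev's argument gives \<open>\<langle>r, A\<^sup>a 1 \<cdot> A\<^sup>b 1\<rangle> \<ge> \<langle>r, A\<^sup>a\<^sup>+\<^sup>b 1\<rangle>\<close> for
  increasing \<open>r\<close>.  Hence removing a leaf of weight \<open>A\<^sup>b 1\<close> at a vertex of weight \<open>A\<^sup>c 1\<close> and changing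
  the weight of that vertex to \<open>A\<^sup>b\<^sup>+\<^sup>c\<^sup>+\<^sup>1 1\<close> does not increase the weighted number of colorings, with
  equality at the end of a path (\<open>c = 0\<close>).  A tree on \<open>n\<close> vertices shrinks in this way to a single
  vertex of weight \<open>A\<^sup>n\<^sup>-\<^sup>1 1\<close>, whose total weight is the number of colorings of the path.
\<close>

section \<open>Growing trees leaf by leaf\<close>

text \<open>Trees presented so that induction removes one leaf at a time. An undirected edge is a
  pair of opposite arcs, hence two new arcs per leaf.\<close>

inductive grown :: "'a pair_pre_digraph \<Rightarrow> bool" where
  single: "grown \<lparr>pverts = {v}, parcs = {}\<rparr>"
| leaf: "\<lbrakk>grown G; u \<in> pverts G; l \<notin> pverts G\<rbrakk> \<Longrightarrow>
    grown \<lparr>pverts = insert l (pverts G), parcs = parcs G \<union> {(u, l), (l, u)}\<rparr>"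

lemma grown_finite: "grown G \<Longrightarrow> finite (pverts G)"
  by (induction rule: grown.induct) auto

lemma grown_nonempty: "grown G \<Longrightarrow> pverts G \<noteq> {}"
  by (induction rule: grown.induct) auto

lemma grown_parcs: "grown G \<Longrightarrow> parcs G \<subseteq> pverts G \<times> pverts G"
  by (induction rule: grown.induct) auto

text \<open>Supplies the path that two edges to an outside vertex would close to a cycle. Keeping it
  inside \<open>S\<close> guarantees that it avoids the outside vertex.\<close>

lemma (in pair_graph) grown_apath:
  assumes "grown S" "pverts S \<subseteq> pverts G" "parcs S \<subseteq> parcs G" "a \<in> pverts S" "b \<in> pverts S"
  shows "\<exists>p. apath a p b \<and> set (pawalk_verts a p) \<subseteq> pverts S"
  using assms
proof (induction arbitrary: a b rule: grown.induct)
  case (single v)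
  then show ?case by (intro exI[of _ "[]"]) (auto simp: apath_def awalk_def)
next
  case (leaf S u l)
  have sub: "pverts S \<subseteq> pverts G" "parcs S \<subseteq> parcs G" "l \<in> pverts G" "(u, l) \<in> parcs G" "(l, u) \<in> parcs G"
    using leaf.prems by auto
  note IH = leaf.IH[OF sub(1,2)]
  consider "a \<in> pverts S" "b \<in> pverts S" | "a = l" "b = l" | "a = l" "b \<in> pverts S"
    | "a \<in> pverts S" "b = l"
    using leaf.prems by auto
  then show ?case
  proof cases
    case 1
    then show ?thesis using IH[of a b] by auto
  next
    case 2
    then show ?thesis using sub by (intro exI[of _ "[]"]) (auto simp: apath_def awalk_def)
  next
    case 3
    obtain p where p: "apath u p b" "set (pawalk_verts u p) \<subseteq> pverts S"
      using IH[OF leaf.hyps(2) 3(2)] by auto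
    then show ?thesis using 3 sub leaf.hyps
      by (intro exI[of _ "(l, u) # p"]) (auto simp: apath_def awalk_def)
  next
    case 4
    obtain p where p: "apath a p u" "set (pawalk_verts a p) \<subseteq> pverts S"
      using IH[OF 4(1) leaf.hyps(2)] by auto
    have ul: "awalk u [(u, l)] l" using sub leaf.hyps by (auto simp: awalk_def)
    have w: "awalk a p u" using p by (simp add: apath_def)
    have "awalk a (p @ [(u, l)]) l"
      using w ul by (rule awalk_appendI)
    moreover have "pawalk_verts a (p @ [(u, l)]) = pawalk_verts a p @ [l]"
      using awalk_verts_append[OF calculation] awlast_of_awalk[OF w] by simp
    ultimately show ?thesis using p 4 leaf.hyps
      by (intro exI[of _ "p @ [(u, l)]"]) (auto simp: apath_def)
  qed
qed

text \<open>
  A maximal grown induced subgraph is everything: otherwise an edge leaves it, and a second edge to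
  the new vertex would close a cycle.
\<close>

lemma undirected_tree_grown:
  assumes "undirected_tree T"
  shows "grown T"
proof -
  have pg: "pair_graph T" and con: "connected (with_proj T)"
    and acyc: "\<And>p. pre_digraph.cycle (with_proj T) p \<Longrightarrow> \<not> 3 \<le> length p"
    using assms by (auto simp: undirected_tree_def)
  interpret pair_graph T by (fact pg)
  have irrefl: "(x, x) \<notin> parcs T" for x
    using no_loops[of "(x, x)"] by auto
  \<comment> \<open>The induced subgraph keeps every arc inside \<open>S\<close>, so that reaching
    all vertices gives \<open>T\<close> itself.\<close>
  define sub where "sub S = \<lparr>pverts = S, parcs = parcs T \<inter> S \<times> S\<rparr>" for S
  define P where "P S \<longleftrightarrow> S \<subseteq> pverts T \<and> grown (sub S)" for S
  have sc: "strongly_connected (with_proj (mk_symmetric (with_proj T)))"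
    using con by (simp add: connected_def)
  then obtain v where v: "v \<in> pverts T"
    by (auto simp: strongly_connected_def)
  have "sub {v} = \<lparr>pverts = {v}, parcs = {}\<rparr>"
    using irrefl by (auto simp: sub_def)
  then have "P {v}"
    using v by (simp add: P_def grown.single)
  moreover have "\<forall>S. P S \<longrightarrow> card S < Suc (card (pverts T))"
    by (auto simp: P_def less_Suc_eq_le intro: card_mono)
  ultimately have "\<exists>S. P S \<and> (\<forall>S'. P S' \<longrightarrow> card S' \<le> card S)"
    by (rule ex_has_greatest_nat)
  then obtain S where S: "P S" and max: "\<And>S'. P S' \<Longrightarrow> card S' \<le> card S"
    by blast
  have ST: "S \<subseteq> pverts T" and gS: "grown (sub S)"
    using S by (auto simp: P_def)
  have "S = pverts T"
  proof (rule ccontr)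
    assume "S \<noteq> pverts T"
    then obtain b where b: "b \<in> pverts T" "b \<notin> S" using ST by auto
    obtain a where a: "a \<in> S" using grown_nonempty[OF gS] by (auto simp: sub_def)
    have "(a, b) \<in> rtrancl_on (pverts T) (parcs (mk_symmetric (with_proj T)))"
      using sc a b ST by (auto simp: strongly_connected_def reachable_def)
    \<comment> \<open>Connectivity refers to the symmetric closure, which adds nothing to
      \<open>T\<close>.\<close>
    moreover have "parcs (mk_symmetric (with_proj T)) = parcs T"
      using pair_sym_arcs by (auto simp: mk_symmetric_def symmetric_def arcs_ends_def sym_def)
    ultimately have "(a, b) \<in> (parcs T)\<^sup>*"
      by (auto dest: rtrancl_on_rtranclI)
    \<comment> \<open>Some arc of the walk from \<open>a\<close> to \<open>b\<close> must leave
      \<open>S\<close>.\<close>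
    then have "\<exists>u w. (u, w) \<in> parcs T \<and> u \<in> S \<and> w \<notin> S"
      using a b(2) by (induction rule: rtrancl_induct) auto
    then obtain u w where uw: "(u, w) \<in> parcs T" "u \<in> S" "w \<notin> S" by blast
    have wu: "(w, u) \<in> parcs T" using uw(1) pair_sym_arcs by (auto simp: symmetric_def dest: symD)
    have wT: "w \<in> pverts T" using uw(1) by (auto dest: in_arcsD2)
    have uniq: "x = u" if x: "x \<in> S" "(x, w) \<in> parcs T" for x
    proof (rule ccontr)
      assume "x \<noteq> u"
      obtain p where p: "apath u p x" "set (pawalk_verts u p) \<subseteq> S"
        using grown_apath[OF gS, of u x] ST uw x by (auto simp: sub_def)
      have aw: "awalk u p x" using p by (simp add: apath_def)
      have "p \<noteq> []" using p \<open>x \<noteq> u\<close> by (auto simp: apath_def awalk_def)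
      have "awalk x [(x, w)] w" using x wT ST by (auto simp: awalk_def)
      with aw have px: "awalk u (p @ [(x, w)]) w" by (rule awalk_appendI)
      have verts: "pawalk_verts u (p @ [(x, w)]) = pawalk_verts u p @ [w]"
        using awalk_verts_append[OF px] awlast_of_awalk[OF aw] by simp
      \<comment> \<open>The closed walk has at least three arcs because \<open>p\<close> is
        nonempty, its ends \<open>u\<close> and \<open>x\<close> being different.\<close>
      have "cycle ((w, u) # p @ [(x, w)])"
        using px verts p wu wT uw(3) by (auto simp: cycle_def apath_def awalk_Cons_iff)
      then have "\<not> 3 \<le> length ((w, u) # p @ [(x, w)])" by (rule acyc)
      then show False using \<open>p \<noteq> []\<close> by (cases p) auto
    qed
    have "sub (insert w S) =
      \<lparr>pverts = insert w (pverts (sub S)), parcs = parcs (sub S) \<union> {(u, w), (w, u)}\<rparr>"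
    proof -
      have in_w: "(x, w) \<in> parcs T \<longleftrightarrow> x = u" if "x \<in> S" for x
        using uniq[OF that] uw(1) by blast
      moreover have "(w, x) \<in> parcs T \<longleftrightarrow> (x, w) \<in> parcs T" for x
        using pair_sym_arcs by (auto simp: symmetric_def dest: symD)
      ultimately have out_w: "(w, x) \<in> parcs T \<longleftrightarrow> x = u" if "x \<in> S" for x
        using that by simp
      have "(x, y) \<in> parcs T \<inter> insert w S \<times> insert w S \<longleftrightarrow>
          (x, y) \<in> parcs T \<inter> S \<times> S \<union> {(u, w), (w, u)}" for x y
        using uw(2,3) by (cases "x = w"; cases "y = w") (auto simp: in_w out_w irrefl)
      then have "parcs T \<inter> insert w S \<times> insert w S = parcs T \<inter> S \<times> S \<union> {(u, w), (w, u)}"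
        by (simp add: set_eq_iff split_paired_all)
      then show ?thesis by (simp add: sub_def)
    qed
    then have "P (insert w S)"
      using grown.leaf[OF gS, of u w] uw wT ST by (simp add: P_def sub_def)
    from max[OF this] show False
      using uw(3) finite_subset[OF ST] by auto
  qed
  moreover have "sub (pverts T) = T"
    by (auto simp: sub_def dest: in_arcsD1 in_arcsD2 intro!: pair_pre_digraph.equality)
  ultimately show ?thesis using gS by simp
qed

text \<open>For \<open>m = 0\<close> truncated subtraction would make the new edge a loop at
  0.\<close>

lemma path_graph_Suc:
  assumes "0 < m"
  shows "path_graph (Suc m) = \<lparr>pverts = insert m (pverts (path_graph m)),
    parcs = parcs (path_graph m) \<union> {(m - 1, m), (m, m - 1)}\<rparr>"
  using assms by (auto simp: path_graph_def)

lemma grown_path_graph: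
  assumes "0 < m"
  shows "grown (path_graph m)"
  using assms
proof (induction m rule: nat_induct_non_zero)
  case 1
  have "path_graph 1 = \<lparr>pverts = {0}, parcs = {}\<rparr>"
    by (auto simp: path_graph_def)
  then show ?case by (simp add: grown.single)
next
  case (Suc m)
  have "m - 1 \<in> pverts (path_graph m)" "m \<notin> pverts (path_graph m)"
    using Suc.hyps by (auto simp: path_graph_def)
  then show ?case
    unfolding path_graph_Suc[OF Suc.hyps] using Suc.IH by (intro grown.leaf)
qed

section \<open>Weighted colorings\<close>

locale ranked_target = pair_pseudo_graph H for H :: "'b pair_pre_digraph" (structure) +
  fixes rank :: "'b \<Rightarrow> nat"
begin

text \<open>This is the adjacency operator \<open>A\<close> of the overview; a loop counts
  once.\<close>

definition nbr_sum :: "('b \<Rightarrow> real) \<Rightarrow> 'b \<Rightarrow> real" where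
  "nbr_sum g x = (\<Sum>y | y \<in> pverts H \<and> (x, y) \<in> parcs H. g y)"

text \<open>Colours of equal rank receive equal values, as the inequality applies both ways.
  Nonnegativity makes the notion stable under products.\<close>

definition increasing :: "('b \<Rightarrow> real) \<Rightarrow> bool" where
  "increasing g \<longleftrightarrow> (\<forall>x\<in>pverts H. 0 \<le> g x) \<and>
     (\<forall>x\<in>pverts H. \<forall>y\<in>pverts H. rank x \<le> rank y \<longrightarrow> g x \<le> g y)"

text \<open>The value at \<open>x\<close> is the number of walks with \<open>k\<close> edges in
  \<open>H\<close> starting at \<open>x\<close>.\<close>

definition walks :: "nat \<Rightarrow> 'b \<Rightarrow> real" where
  "walks k = (nbr_sum ^^ k) (\<lambda>_. 1)"

definition weight :: "'a pair_pre_digraph \<Rightarrow> ('a \<Rightarrow> 'b \<Rightarrow> real) \<Rightarrow> real" where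
  "weight G g = (\<Sum>f\<in>colorings G H. \<Prod>v\<in>pverts G. g v (f v))"

text \<open>The indicator replaces the weight of \<open>q\<close>, so \<open>g q\<close> drops out
  and must be multiplied back where it is wanted.\<close>

abbreviation rooted :: "'a pair_pre_digraph \<Rightarrow> ('a \<Rightarrow> 'b \<Rightarrow> real) \<Rightarrow> 'a \<Rightarrow> 'b \<Rightarrow> real" where
  "rooted G g q z \<equiv> weight G (g(q := indicator {z}))"

lemma finite_colorings:
  assumes "finite (pverts G)"
  shows "finite (colorings G H)"
proof (rule finite_subset)
  show "colorings G H \<subseteq> pverts G \<rightarrow>\<^sub>E pverts H"
    by (simp add: colorings_def)
  show "finite (pverts G \<rightarrow>\<^sub>E pverts H)"
    using assms pair_finite_verts by (rule finite_PiE)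
qed

lemma hom_count_weight: "real (hom_count G H) = weight G (\<lambda>_ _. 1)"
  by (simp add: hom_count_def weight_def)

lemma weight_cong:
  assumes "\<And>v x. v \<in> pverts G \<Longrightarrow> x \<in> pverts H \<Longrightarrow> g v x = g' v x"
  shows "weight G g = weight G g'"
  unfolding weight_def using assms
  by (intro sum.cong prod.cong refl) (auto simp: colorings_def PiE_def)

lemma weight_single:
  "weight \<lparr>pverts = {v}, parcs = {}\<rparr> g = (\<Sum>x\<in>pverts H. g v x)"
proof -
  have "colorings \<lparr>pverts = {v}, parcs = {}\<rparr> H = (\<lambda>x. (\<lambda>_. undefined)(v := x)) ` pverts H"
    by (simp add: colorings_def PiE_insert_eq image_image)
      (auto simp: image_iff)
  moreover have "inj_on (\<lambda>x. (\<lambda>_. undefined)(v := x)) (pverts H)"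
    by (auto simp: inj_on_def dest: fun_upd_eqD)
  ultimately show ?thesis
    by (simp add: weight_def sum.reindex)
qed

text \<open>Only the colour of \<open>u\<close> constrains that of \<open>l\<close>. Summing over
  the colour of \<open>l\<close> first leaves the factor \<open>nbr_sum (g l)\<close> at
  \<open>u\<close>.\<close>

lemma weight_leaf:
  assumes "finite (pverts G)" "parcs G \<subseteq> pverts G \<times> pverts G" "u \<in> pverts G" "l \<notin> pverts G"
  shows "weight \<lparr>pverts = insert l (pverts G), parcs = parcs G \<union> {(u, l), (l, u)}\<rparr> g =
    weight G (g(u := \<lambda>x. g u x * nbr_sum (g l) x))" (is "weight ?G g = weight G ?g")
proof -
  define D where "D = Sigma (colorings G H) (\<lambda>f. {y \<in> pverts H. (f u, y) \<in> parcs H})"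
  define \<phi> where "\<phi> = (\<lambda>(f, y). (f :: 'a \<Rightarrow> 'b)(l := y))"
  have lu: "l \<noteq> u" using assms by auto
  have "bij_betw \<phi> D (colorings ?G H)"
  \<comment> \<open>Removing the leaf resets it to \<open>undefined\<close>, because colorings are
    extensional functions on the vertex set.\<close>
  proof (rule bij_betw_byWitness[where f' = "\<lambda>f. (f(l := undefined), f l)"])
    show "\<forall>a\<in>D. (\<lambda>f. (f(l := undefined), f l)) (\<phi> a) = a"
      using assms by (auto simp: D_def \<phi>_def colorings_def PiE_def extensional_def fun_eq_iff)
    show "\<forall>f\<in>colorings ?G H. \<phi> (f(l := undefined), f l) = f"
      by (auto simp: \<phi>_def)
    show "\<phi> ` D \<subseteq> colorings ?G H"
      using assms lu pair_sym_arcs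
      by (auto simp: D_def \<phi>_def colorings_def PiE_def Pi_def extensional_def symmetric_def dest: symD)
    show "(\<lambda>f. (f(l := undefined), f l)) ` colorings ?G H \<subseteq> D"
      using assms lu
      by (fastforce simp: D_def colorings_def PiE_def Pi_def extensional_def)
  qed
  from sum.reindex_bij_betw[OF this, symmetric, of "\<lambda>f. \<Prod>v\<in>insert l (pverts G). g v (f v)"]
  have "weight ?G g = (\<Sum>d\<in>D. \<Prod>v\<in>insert l (pverts G). g v (\<phi> d v))"
    unfolding weight_def by (simp only: pair_pre_digraph.simps)
  also have "\<dots> = (\<Sum>(f, y)\<in>D. (\<Prod>v\<in>pverts G. g v (f v)) * g l y)"
  proof (intro sum.cong refl, clarify)
    fix f y assume "(f, y) \<in> D"
    have "(\<Prod>v\<in>pverts G. g v ((f(l := y)) v)) = (\<Prod>v\<in>pverts G. g v (f v))"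
      using assms(4) by (intro prod.cong) auto
    then show "(\<Prod>v\<in>insert l (pverts G). g v (\<phi> (f, y) v)) = (\<Prod>v\<in>pverts G. g v (f v)) * g l y"
      using assms by (simp add: \<phi>_def mult.commute)
  qed
  also have "\<dots> = (\<Sum>f\<in>colorings G H. (\<Prod>v\<in>pverts G. g v (f v)) * nbr_sum (g l) (f u))"
    unfolding D_def nbr_sum_def using assms(1)
    by (subst sum.Sigma[symmetric]) (auto simp: finite_colorings sum_distrib_left)
  also have "\<dots> = weight G ?g"
    unfolding weight_def
  proof (intro sum.cong refl)
    fix f
    have "(\<Prod>v\<in>pverts G - {u}. ?g v (f v)) = (\<Prod>v\<in>pverts G - {u}. g v (f v))"
      by (intro prod.cong) auto
    then show "(\<Prod>v\<in>pverts G. g v (f v)) * nbr_sum (g l) (f u) = (\<Prod>v\<in>pverts G. ?g v (f v))"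
      using assms by (simp add: prod.remove[OF assms(1,3)])
  qed
  finally show ?thesis .
qed

text \<open>The weight is linear in the factor at \<open>q\<close>; the sum is split by the colour
  of \<open>q\<close>.\<close>

lemma weight_expand:
  assumes "finite (pverts G)" "q \<in> pverts G"
  shows "weight G (g(q := h)) = (\<Sum>z\<in>pverts H. h z * rooted G g q z)"
proof -
  have "h (f q) * P = (\<Sum>z\<in>pverts H. h z * (indicator {z} (f q) * P))"
    if "f \<in> colorings G H" for f and P :: real
  proof -
    have "f q \<in> pverts H" using that assms by (auto simp: colorings_def)
    then show ?thesis
      using pair_finite_verts
      by (subst sum.remove[of _ "f q"]) (auto simp: indicator_def intro!: sum.neutral)
  qed
  moreover have "(\<Prod>v\<in>pverts G. (g(q := k)) v (f v)) = k (f q) * (\<Prod>v\<in>pverts G - {q}. g v (f v))"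
    for k and f :: "'a \<Rightarrow> 'b"
    by (subst prod.remove[OF assms]) (auto intro!: arg_cong2[where f = "(*)"] prod.cong)
  ultimately show ?thesis
    unfolding weight_def sum_distrib_left by (subst sum.swap) (simp cong: sum.cong)
qed

section \<open>Symmetry of the adjacency operator and Chebyshev's inequality\<close>

lemma nbr_sum_adjoint:
  "(\<Sum>x\<in>pverts H. f x * nbr_sum g x) = (\<Sum>x\<in>pverts H. nbr_sum f x * g x)"
proof -
  have eq: "(y, x) \<in> parcs H \<longleftrightarrow> (x, y) \<in> parcs H" for x y
    using pair_sym_arcs by (auto simp: symmetric_def dest: symD)
  have ns: "nbr_sum h x = (\<Sum>y\<in>pverts H. if (x, y) \<in> parcs H then h y else 0)" for h x
    using pair_finite_verts by (simp add: nbr_sum_def sum.inter_filter)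
  show ?thesis
    unfolding ns sum_distrib_left sum_distrib_right
    by (subst sum.swap) (auto intro!: sum.cong simp: eq)
qed

lemma funpow_nbr_sum_adjoint:
  "(\<Sum>x\<in>pverts H. f x * (nbr_sum ^^ k) g x) = (\<Sum>x\<in>pverts H. (nbr_sum ^^ k) f x * g x)"
proof (induction k arbitrary: f)
  case (Suc k)
  have "(nbr_sum ^^ Suc k) f = (nbr_sum ^^ k) (nbr_sum f)"
    by (simp add: funpow_swap1)
  then show ?case by (simp add: nbr_sum_adjoint Suc.IH)
qed simp

lemma sum_indicator:
  assumes "x \<in> pverts H"
  shows "(\<Sum>z\<in>pverts H. indicator {x} z * h z) = (h x :: real)"
  using assms pair_finite_verts
  by (subst sum.remove[of _ x]) (auto simp: indicator_def intro!: sum.neutral)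

lemma nbr_sum_nonneg: "(\<And>x. x \<in> pverts H \<Longrightarrow> 0 \<le> g x) \<Longrightarrow> 0 \<le> nbr_sum g x"
  unfolding nbr_sum_def by (rule sum_nonneg) auto

lemma funpow_nbr_sum_nonneg:
  "(\<And>x. 0 \<le> g x) \<Longrightarrow> 0 \<le> (nbr_sum ^^ k) g x"
  by (induction k arbitrary: x) (auto intro: nbr_sum_nonneg)

lemma increasing_chebyshev:
  assumes r: "increasing r" and g: "increasing g"
  shows "(\<Sum>x\<in>pverts H. r x * (nbr_sum ^^ k) g x) \<le> (\<Sum>x\<in>pverts H. r x * (walks k x * g x))"
proof -
  \<comment> \<open>\<open>K\<close> is the matrix of the \<open>k\<close>-th power of the adjacency
    operator; its row sums are \<open>walks k\<close>.\<close>
  define K where "K x y = (nbr_sum ^^ k) (indicator {x}) y" for x y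
  have K_sym: "K x y = K y x" if "x \<in> pverts H" "y \<in> pverts H" for x y
    using funpow_nbr_sum_adjoint[of "indicator {x}" k "indicator {y}"] that
    by (simp add: K_def sum_indicator mult.commute[of _ "indicator _ _"])
  have K: "(nbr_sum ^^ k) h x = (\<Sum>y\<in>pverts H. K x y * h y)" if "x \<in> pverts H" for h x
    using funpow_nbr_sum_adjoint[of "indicator {x}" k h] that by (simp add: K_def sum_indicator)
  have K_nonneg: "0 \<le> K x y" for x y
    unfolding K_def by (rule funpow_nbr_sum_nonneg) simp
  define S where "S = (\<Sum>x\<in>pverts H. \<Sum>y\<in>pverts H. K x y * r x * (g x - g y))"
  have "(\<Sum>x\<in>pverts H. r x * (walks k x * g x)) - (\<Sum>x\<in>pverts H. r x * (nbr_sum ^^ k) g x) = S"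
    unfolding S_def sum_subtractf[symmetric] walks_def
    by (intro sum.cong refl)
      (simp add: K sum_distrib_left sum_distrib_right sum_subtractf[symmetric] algebra_simps)
  moreover have "0 \<le> 2 * S"
  proof -
    \<comment> \<open>Exchanging \<open>x\<close> and \<open>y\<close> and adding both forms of
      \<open>S\<close> produces the product of differences.\<close>
    have "S = (\<Sum>x\<in>pverts H. \<Sum>y\<in>pverts H. K x y * r y * (g y - g x))"
      unfolding S_def by (subst sum.swap) (auto intro!: sum.cong simp: K_sym)
    then have "2 * S = (\<Sum>x\<in>pverts H. \<Sum>y\<in>pverts H.
        K x y * r x * (g x - g y) + K x y * r y * (g y - g x))"
      unfolding sum.distrib using S_def by simp
    also have "\<dots> = (\<Sum>x\<in>pverts H. \<Sum>y\<in>pverts H. K x y * ((r x - r y) * (g x - g y)))"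
      by (intro sum.cong refl) (simp add: algebra_simps)
    finally have "2 * S = (\<Sum>x\<in>pverts H. \<Sum>y\<in>pverts H. K x y * ((r x - r y) * (g x - g y)))" .
    moreover have "0 \<le> (\<Sum>x\<in>pverts H. \<Sum>y\<in>pverts H. K x y * ((r x - r y) * (g x - g y)))"
    proof (intro sum_nonneg mult_nonneg_nonneg[OF K_nonneg])
      fix x y assume "x \<in> pverts H" "y \<in> pverts H"
      \<comment> \<open>Ranks are linearly ordered, so \<open>r\<close> and \<open>g\<close> order
        \<open>x\<close> and \<open>y\<close> the same way.\<close>
      then have "(r x \<le> r y \<and> g x \<le> g y) \<or> (r y \<le> r x \<and> g y \<le> g x)"
        using r g linear[of "rank x" "rank y"] by (auto simp: increasing_def)
      then show "0 \<le> (r x - r y) * (g x - g y)"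
        by (auto intro: mult_nonneg_nonneg mult_nonpos_nonpos)
    qed
    ultimately show ?thesis by simp
  qed
  ultimately show ?thesis by linarith
qed

lemma increasing_cong:
  "increasing g \<Longrightarrow> (\<And>x. x \<in> pverts H \<Longrightarrow> f x = g x) \<Longrightarrow> increasing f"
  by (simp add: increasing_def)

lemma increasing_mult: "increasing f \<Longrightarrow> increasing g \<Longrightarrow> increasing (\<lambda>x. f x * g x)"
  unfolding increasing_def by (auto intro!: mult_mono)

lemma walks_add: "(nbr_sum ^^ j) (walks k) = walks (j + k)"
  by (simp add: walks_def funpow_add)

text \<open>Removing the end vertex turns the weight 1 of its neighbour into
  \<open>walks (Suc k)\<close>, with no loss. The general \<open>k\<close> is what the induction
  needs.\<close>

lemma weight_path_graph:
  assumes "0 < m"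
  shows "weight (path_graph m) ((\<lambda>_ _. 1)(m - 1 := walks k)) = (\<Sum>x\<in>pverts H. walks (m - 1 + k) x)"
  using assms
proof (induction m arbitrary: k rule: nat_induct_non_zero)
  case 1
  have "path_graph 1 = \<lparr>pverts = {0}, parcs = {}\<rparr>"
    by (auto simp: path_graph_def)
  then show ?case by (simp add: weight_single)
next
  case (Suc m)
  let ?g = "(\<lambda>_ _. 1)(m := walks k)"
  have "weight (path_graph (Suc m)) ?g =
      weight (path_graph m) (?g(m - 1 := \<lambda>x. ?g (m - 1) x * nbr_sum (?g m) x))"
    unfolding path_graph_Suc[OF Suc.hyps] using Suc.hyps
    by (intro weight_leaf grown_parcs grown_path_graph) (auto simp: path_graph_def)
  also have "\<dots> = weight (path_graph m) ((\<lambda>_ _. 1)(m - 1 := walks (Suc k)))"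
    using Suc.hyps by (intro weight_cong) (auto simp: path_graph_def walks_def)
  also have "\<dots> = (\<Sum>x\<in>pverts H. walks (m - 1 + Suc k) x)"
    by (rule Suc.IH)
  finally show ?case
    using Suc.hyps by (simp only: diff_Suc_1 add_Suc_right Suc_diff_1 flip: add_Suc)
qed

lemma hom_count_path_graph:
  assumes "0 < m"
  shows "real (hom_count (path_graph m) H) = (\<Sum>x\<in>pverts H. walks (m - 1) x)"
proof -
  have "(\<lambda>_ _. 1)(m - 1 := walks 0) = (\<lambda>_ _. 1)"
    by (simp add: fun_eq_iff walks_def)
  with weight_path_graph[OF assms, of 0] show ?thesis
    by (simp only: hom_count_weight add_0_right)
qed

section \<open>Targets whose adjacency operator preserves increasing functions\<close>

context
  assumes increasing_nbr_sum: "\<And>g. increasing g \<Longrightarrow> increasing (nbr_sum g)"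
begin

lemma increasing_walks: "increasing (walks k)"
proof (induction k)
  case 0
  then show ?case by (simp add: walks_def increasing_def)
next
  case (Suc k)
  then show ?case using increasing_nbr_sum by (simp add: walks_def)
qed

text \<open>Induction over the growth, for all weights and roots at once: removing a leaf changes
  the weight of \<open>u\<close>, and the root may be the leaf, its neighbour or another
  vertex.\<close>

lemma increasing_rooted:
  assumes "grown G" "\<And>v. v \<in> pverts G \<Longrightarrow> increasing (g v)" "q \<in> pverts G"
  shows "increasing (rooted G g q)"
  using assms
proof (induction arbitrary: g q rule: grown.induct)
  case (single v)
  have "rooted \<lparr>pverts = {v}, parcs = {}\<rparr> g v z = 1" if "z \<in> pverts H" for z
    using sum_indicator[OF that, of "\<lambda>_. 1"] by (simp add: weight_single indicator_def eq_commute)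
  moreover have "increasing (\<lambda>_. 1)" by (simp add: increasing_def)
  moreover have "q = v" using single.prems by simp
  ultimately show ?case by (blast intro: increasing_cong)
next
  case (leaf G u l)
  let ?G = "\<lparr>pverts = insert l (pverts G), parcs = parcs G \<union> {(u, l), (l, u)}\<rparr>"
  note fin = grown_finite[OF leaf.hyps(1)]
  note peel = weight_leaf[OF fin grown_parcs[OF leaf.hyps(1)] leaf.hyps(2,3)]
  have lu: "l \<noteq> u" using leaf.hyps by auto
  have inc: "increasing (g v)" if "v \<in> pverts G" for v using leaf.prems that by simp
  have incl: "increasing (nbr_sum (g l))" using leaf.prems by (simp add: increasing_nbr_sum)
  have incu: "increasing (rooted G g u)" using inc leaf.hyps(2) by (rule leaf.IH)
  consider "q = l" | "q = u" | "q \<noteq> l" "q \<noteq> u" "q \<in> pverts G" using leaf.prems by auto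
  then show ?case
  proof cases
    case 1
    \<comment> \<open>Adjointness moves the operator from the indicator at the leaf to the rooted
      weights at \<open>u\<close>.\<close>
    have "rooted ?G g q z = nbr_sum (\<lambda>y. g u y * rooted G g u y) z" if z: "z \<in> pverts H" for z
    proof -
      have "rooted ?G g q z = weight G (g(u := \<lambda>x. g u x * nbr_sum (indicator {z}) x))"
        using 1 lu leaf.hyps by (subst peel) (auto intro!: weight_cong)
      also have "\<dots> = (\<Sum>x\<in>pverts H. (g u x * rooted G g u x) * nbr_sum (indicator {z}) x)"
        by (subst weight_expand[OF fin leaf.hyps(2)]) (simp add: mult_ac)
      also have "\<dots> = (\<Sum>x\<in>pverts H. indicator {z} x * nbr_sum (\<lambda>y. g u y * rooted G g u y) x)"
        by (subst nbr_sum_adjoint) (simp only: mult.commute)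
      also have "\<dots> = nbr_sum (\<lambda>y. g u y * rooted G g u y) z"
        using z by (rule sum_indicator)
      finally show ?thesis .
    qed
    moreover have "increasing (nbr_sum (\<lambda>y. g u y * rooted G g u y))"
      using incu inc leaf.hyps by (intro increasing_nbr_sum increasing_mult) auto
    ultimately show ?thesis by (blast intro: increasing_cong)
  next
    case 2
    have "rooted ?G g q z = nbr_sum (g l) z * rooted G g u z" if z: "z \<in> pverts H" for z
    proof -
      have "rooted ?G g q z = weight G (g(u := \<lambda>x. indicator {z} x * nbr_sum (g l) x))"
        using 2 lu by (subst peel) simp
      also have "\<dots> = nbr_sum (g l) z * rooted G g u z"
        using z by (subst weight_expand[OF fin leaf.hyps(2)]) (simp add: mult.assoc sum_indicator)
      finally show ?thesis .
    qed
    moreover have "increasing (\<lambda>z. nbr_sum (g l) z * rooted G g u z)"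
      using incl incu by (rule increasing_mult)
    ultimately show ?thesis by (blast intro: increasing_cong)
  next
    case 3
    let ?g = "g(u := \<lambda>x. g u x * nbr_sum (g l) x)"
    have "rooted ?G g q = rooted G ?g q"
      \<comment> \<open>Updates at the distinct vertices \<open>u\<close> and \<open>q\<close>
        commute.\<close>
      using 3 lu by (intro ext, subst peel) (simp add: fun_upd_twist)
    moreover have "increasing (rooted G ?g q)"
      using 3 inc incl by (intro leaf.IH) (auto intro: increasing_mult)
    ultimately show ?thesis by (simp only:)
  qed
qed

text \<open>The right side counts colorings of \<open>G\<close> with a pendant path of
  \<open>b v\<close> edges attached at each \<open>v\<close>; the left side counts those of the path
  with equally many vertices.\<close>

lemma weight_grown_ge:
  assumes "grown G"
  shows "(\<Sum>x\<in>pverts H. walks (card (pverts G) - 1 + (\<Sum>v\<in>pverts G. b v)) x)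
    \<le> weight G (\<lambda>v. walks (b v))"
  using assms
proof (induction arbitrary: b rule: grown.induct)
  case (single v)
  then show ?case by (simp add: weight_single)
next
  case (leaf G u l)
  note fin = grown_finite[OF leaf.hyps(1)]
  note peel = weight_leaf[OF fin grown_parcs[OF leaf.hyps(1)] leaf.hyps(2,3)]
  \<comment> \<open>\<open>u\<close> absorbs the edge to \<open>l\<close> and the \<open>b l\<close>
    edges hanging there, so the total number of edges is kept.\<close>
  let ?g = "\<lambda>v. walks (b v)" and ?b = "b(u := Suc (b l) + b u)"
  have card: "0 < card (pverts G)" using fin leaf.hyps(2) by (auto simp: card_gt_0_iff)
  have "(\<Sum>v\<in>pverts G - {u}. ?b v) = (\<Sum>v\<in>pverts G - {u}. b v)"
    by (intro sum.cong) auto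
  then have "(\<Sum>v\<in>pverts G. ?b v) = Suc (\<Sum>v\<in>insert l (pverts G). b v)"
    using leaf.hyps(3) by (simp add: sum.remove[OF fin leaf.hyps(2)] fin)
  then have "card (insert l (pverts G)) - 1 + (\<Sum>v\<in>insert l (pverts G). b v) =
      card (pverts G) - 1 + (\<Sum>v\<in>pverts G. ?b v)"
    using card leaf.hyps(3) fin by simp
  also have "(\<Sum>x\<in>pverts H. walks \<dots> x) \<le> weight G (\<lambda>v. walks (?b v))"
    by (rule leaf.IH)
  also have "(\<lambda>v. walks (?b v)) = ?g(u := (nbr_sum ^^ Suc (b l)) (walks (b u)))"
    by (auto simp: walks_add simp del: funpow.simps)
  also have "weight G \<dots> = (\<Sum>z\<in>pverts H. rooted G ?g u z * (nbr_sum ^^ Suc (b l)) (walks (b u)) z)"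
    by (subst weight_expand[OF fin leaf.hyps(2)]) (simp add: mult.commute)
  \<comment> \<open>The only inequality besides the induction hypothesis: one long pendant path at
    \<open>u\<close> is split into two.\<close>
  also have "\<dots> \<le> (\<Sum>z\<in>pverts H. rooted G ?g u z * (walks (Suc (b l)) z * walks (b u) z))"
    using leaf.hyps by (intro increasing_chebyshev increasing_rooted increasing_walks)
  also have "\<dots> = weight G (?g(u := \<lambda>x. walks (b u) x * nbr_sum (walks (b l)) x))"
    by (subst weight_expand[OF fin leaf.hyps(2)]) (simp add: mult_ac walks_def)
  finally show ?case by (simp only: peel pair_pre_digraph.simps)
qed

lemma hoffman_london_if_increasing_nbr_sum: "hoffman_london H"
  unfolding hoffman_london_def
proof (intro allI impI)
  fix m :: nat assume m: "1 \<le> m"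
  show "hom_count (path_graph m) H = Min ((\<lambda>T. hom_count T H) ` trees m)"
  proof (rule Min_eqI[symmetric])
    fix k assume "k \<in> (\<lambda>T. hom_count T H) ` trees m"
    then obtain T where T: "undirected_tree T" "pverts T = {0..<m}" "k = hom_count T H"
      by (auto simp: trees_def)
    have "real (hom_count (path_graph m) H) \<le> weight T (\<lambda>_. walks 0)"
      using weight_grown_ge[OF undirected_tree_grown[OF T(1)], of "\<lambda>_. 0"] T(2) m
      by (simp add: hom_count_path_graph)
    also have "\<dots> = real k"
      using T(3) by (simp add: hom_count_weight walks_def)
    finally show "hom_count (path_graph m) H \<le> k" by simp
  qed (use m in \<open>auto simp: finite_trees path_graph_in_trees\<close>)
qed

end

end

section \<open>Blow-ups of looped stars\<close>

theorem corollary4p14: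
  fixes t :: nat and n :: "nat \<Rightarrow> nat"
  assumes "1 \<le> t"
    and "\<And>i. i \<le> t \<Longrightarrow> 0 < n i"
  shows "hoffman_london (blow_up (looped_star t) n)"
proof -
  let ?H = "blow_up (looped_star t) n"
  \<comment> \<open>The successor of the total puts the center strictly above every leaf class,
    whatever its own size.\<close>
  define rank where "rank = (\<lambda>(i, a :: nat). if i = 0 then Suc (\<Sum>i\<le>t. n i) else n i)"
  interpret ranked_target ?H rank
    using pair_pseudo_graph_blow_up[OF pair_pseudo_graph_looped_star]
    by (simp add: ranked_target_def)
  have verts: "(i, a) \<in> pverts ?H \<longleftrightarrow> i \<le> t \<and> a < n i" for i a
    by (simp add: blow_up_def looped_star_def)
  have nbrs: "{y. y \<in> pverts ?H \<and> ((i, a), y) \<in> parcs ?H} = (SIGMA j : {0, i}. {0..<n j})"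
    if "(i, a) \<in> pverts ?H" "i \<noteq> 0" for i a
    using that by (auto simp: blow_up_def looped_star_def)
  have nbrs0: "{y. y \<in> pverts ?H \<and> ((0, a), y) \<in> parcs ?H} = pverts ?H"
    if "(0, a) \<in> pverts ?H" for a
    using that by (auto simp: blow_up_def looped_star_def)
  have le: "n i \<le> (\<Sum>i\<le>t. n i)" if "i \<le> t" for i
    using that by (intro member_le_sum) auto
  show ?thesis
  proof (rule hoffman_london_if_increasing_nbr_sum)
    fix g assume g: "increasing g"
    have nonneg: "0 \<le> g x" if "x \<in> pverts ?H" for x
      using g that by (simp add: increasing_def)
    have mono: "g x \<le> g y" if "x \<in> pverts ?H" "y \<in> pverts ?H" "rank x \<le> rank y" for x y
      using g that by (simp add: increasing_def)
    \<comment> \<open>The central sum is common to all leaf colours, so only the second term has to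
      be compared.\<close>
    have leaf: "nbr_sum g (i, a) = (\<Sum>b = 0..<n 0. g (0, b)) + real (n i) * g (i, a)"
      if x: "(i, a) \<in> pverts ?H" "i \<noteq> 0" for i a
    proof -
      \<comment> \<open>All vertices of a class have the same rank.\<close>
      have "g (i, b) = g (i, a)" if "b < n i" for b
        using x that by (intro order.antisym mono) (auto simp: verts rank_def)
      then have "(\<Sum>b = 0..<n i. g (i, b)) = real (n i) * g (i, a)"
        by simp
      then show ?thesis
        using x(2) unfolding nbr_sum_def nbrs[OF x]
        by (subst sum.Sigma[symmetric, of _ _ "\<lambda>j b. g (j, b)", simplified]) auto
    qed
    have "nbr_sum g (i, a) \<le> nbr_sum g (j, b)"
      if x: "(i, a) \<in> pverts ?H" and y: "(j, b) \<in> pverts ?H" and r: "rank (i, a) \<le> rank (j, b)"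
      for i a j b
    proof (cases "j = 0")
      case True
      \<comment> \<open>A central colour is adjacent to every colour, so its sum dominates by
        nonnegativity.\<close>
      then show ?thesis
        using y pair_finite_verts nonneg unfolding nbr_sum_def
        by (intro sum_mono2) (auto simp: nbrs0)
    next
      case False
      then have i: "i \<noteq> 0"
        using r le[of j] y by (auto simp: rank_def verts split: if_splits)
      \<comment> \<open>Ranking leaf colours by class size makes both factors monotone.\<close>
      have "real (n i) * g (i, a) \<le> real (n j) * g (j, b)"
        using r i False nonneg[OF x] mono[OF x y r] by (intro mult_mono) (auto simp: rank_def)
      then show ?thesis using leaf[OF x i] leaf[OF y False] by simp
    qed
    then show "increasing (nbr_sum g)"
      unfolding increasing_def using nonneg by (auto intro: nbr_sum_nonneg)
  qed
qed

end
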